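(* Let $n\ge 2$ and let $B_n$ be the braid group on $n$ strands with Artin generators $\sigma_1,\dots,\sigma_{n-1}$. Let $\mathbb{Z}[t^{\pm1},b^{\pm1}]$ be the ring of Laurent polynomials in two variables $t,b$ over $\mathbb{Z}$. Then the assignment $$\Psi(\sigma_i):=I_{i-1}\oplus\begin{pmatrix}0&t\\ b&0\end{pmatrix}\oplus I_{n-i-1},\qquad 1\le i\le n-1,$$ defines a representation (group homomorphism) $\Psi:B_n\to GL_n(\mathbb{Z}[t^{\pm1},b^{\pm1}])$. Moreover, for every $1\le i\le n-1$, $$\Psi(\sigma_i^{-1})=I_{i-1}\oplus\begin{pmatrix}0&b^{-1}\\ t^{-1}&0\end{pmatrix}\oplus I_{n-i-1}.$$
   Context: The braid group $B_n$ is the group generated by $\sigma_1,\dots,\sigma_{n-1}$ subject to the relations $\sigma_i\sigma_{i+1}\sigma_i=\sigma_{i+1}\sigma_i\sigma_{i+1}$ for $1\le i\le n-2$ and $\sigma_i\sigma_j=\sigma_j\sigma_i$ for $|i-j|\ge 2$. $I_k$ denotes the $k\times k$ identity matrix (empty if $k=0$), and $\oplus$ denotes the block-diagonal sum of matrices. *)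

theory Defs
  imports
    "HOL-Library.Poly_Mapping"
    "HOL-Library.Product_Plus"
    "HOL-Algebra.Group"
    "Jordan_Normal_Form.Matrix"
begin

section \<open>Groups given by generators and relations\<close>

text \<open>
  The letter \<open>(x, True)\<close> stands for the generator \<open>x\<close> and \<open>(x, False)\<close> for its formal inverse.
\<close>

type_synonym 'a gword = "('a \<times> bool) list"

definition gwords :: "'a set \<Rightarrow> 'a gword set" where
  "gwords X = lists (X \<times> (UNIV :: bool set))"

text \<open>
  The least congruence on the words over \<open>X\<close> that cancels adjacent inverse letters and
  identifies \<open>r\<close> with \<open>s\<close> for every \<open>(r, s)\<close> in \<open>R\<close> (i.e. imposes the relation \<open>r = s\<close>).
\<close>

inductive_set pres_rel :: "'a set \<Rightarrow> ('a gword \<times> 'a gword) set \<Rightarrow> ('a gword \<times> 'a gword) set"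
  for X R where
  cancel: "x \<in> X \<Longrightarrow> ([(x, e), (x, \<not> e)], []) \<in> pres_rel X R"
| rel: "(r, s) \<in> R \<Longrightarrow> r \<in> gwords X \<Longrightarrow> s \<in> gwords X \<Longrightarrow> (r, s) \<in> pres_rel X R"
| refl: "u \<in> gwords X \<Longrightarrow> (u, u) \<in> pres_rel X R"
| sym: "(u, v) \<in> pres_rel X R \<Longrightarrow> (v, u) \<in> pres_rel X R"
| trans: "(u, v) \<in> pres_rel X R \<Longrightarrow> (v, w) \<in> pres_rel X R \<Longrightarrow> (u, w) \<in> pres_rel X R"
| append: "(u, v) \<in> pres_rel X R \<Longrightarrow> (u', v') \<in> pres_rel X R \<Longrightarrow> (u @ u', v @ v') \<in> pres_rel X R"

definition presented_group :: "'a set \<Rightarrow> ('a gword \<times> 'a gword) set \<Rightarrow> 'a gword set monoid" where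
  "presented_group X R = \<lparr>
     carrier = gwords X // pres_rel X R,
     monoid.mult = (\<lambda>A B. \<Union>u\<in>A. \<Union>v\<in>B. pres_rel X R `` {u @ v}),
     one = pres_rel X R `` {[]}\<rparr>"

lemma pres_rel_words: "(u, v) \<in> pres_rel X R \<Longrightarrow> u \<in> gwords X \<and> v \<in> gwords X"
  by (induction rule: pres_rel.induct) (auto simp: gwords_def)

lemma equiv_pres_rel: "equiv (gwords X) (pres_rel X R)"
proof (rule equivI)
  show "pres_rel X R \<subseteq> gwords X \<times> gwords X"
    using pres_rel_words by fast
  show "refl_on (gwords X) (pres_rel X R)"
    by (rule refl_onI) (rule pres_rel.refl)
  show "Relation.sym (pres_rel X R)"
    by (rule symI) (rule pres_rel.sym)
  show "Relation.trans (pres_rel X R)"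
    by (rule transI) (rule pres_rel.trans)
qed

lemma presented_group_mult:
  assumes "u \<in> gwords X" and "v \<in> gwords X"
  shows "pres_rel X R `` {u} \<otimes>\<^bsub>presented_group X R\<^esub> pres_rel X R `` {v} = pres_rel X R `` {u @ v}"
proof -
  have "pres_rel X R `` {u' @ v'} = pres_rel X R `` {u @ v}"
    if "(u, u') \<in> pres_rel X R" "(v, v') \<in> pres_rel X R" for u' v'
    using equiv_class_eq[OF equiv_pres_rel pres_rel.append[OF that]] by simp
  moreover have "(u, u) \<in> pres_rel X R" "(v, v) \<in> pres_rel X R"
    using assms by (auto intro: pres_rel.refl)
  ultimately have "(\<Union>u'\<in>pres_rel X R `` {u}. \<Union>v'\<in>pres_rel X R `` {v}. pres_rel X R `` {u' @ v'})
      = pres_rel X R `` {u @ v}"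
    by blast
  then show ?thesis
    by (simp add: presented_group_def)
qed

lemma group_presented_group: "group (presented_group X R)"
proof (rule groupI)
  let ?G = "presented_group X R"
  let ?c = "\<lambda>w. pres_rel X R `` {w}"
  have carr: "x \<in> carrier ?G \<longleftrightarrow> (\<exists>w\<in>gwords X. x = ?c w)" for x
    by (auto simp: presented_group_def quotient_def)
  have one: "\<one>\<^bsub>?G\<^esub> = ?c []"
    by (simp add: presented_group_def)
  have Nil: "[] \<in> gwords X" and app: "u \<in> gwords X \<Longrightarrow> v \<in> gwords X \<Longrightarrow> u @ v \<in> gwords X" for u v
    by (auto simp: gwords_def)
  note m = presented_group_mult[of _ X _ R]
  show "\<one>\<^bsub>?G\<^esub> \<in> carrier ?G"
    unfolding carr one by (rule bexI[of _ "[]"]) (simp_all add: Nil)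
  show "x \<otimes>\<^bsub>?G\<^esub> y \<in> carrier ?G" if xy: "x \<in> carrier ?G" "y \<in> carrier ?G" for x y
  proof -
    obtain u v where "u \<in> gwords X" "x = ?c u" "v \<in> gwords X" "y = ?c v"
      using xy carr by auto
    then show ?thesis
      unfolding carr by (intro bexI[of _ "u @ v"]) (simp_all add: m app)
  qed
  show "x \<otimes>\<^bsub>?G\<^esub> y \<otimes>\<^bsub>?G\<^esub> z = x \<otimes>\<^bsub>?G\<^esub> (y \<otimes>\<^bsub>?G\<^esub> z)"
    if xyz: "x \<in> carrier ?G" "y \<in> carrier ?G" "z \<in> carrier ?G" for x y z
  proof -
    obtain u v w where "u \<in> gwords X" "x = ?c u" "v \<in> gwords X" "y = ?c v"
        "w \<in> gwords X" "z = ?c w"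
      using xyz carr by auto
    then show ?thesis
      by (simp add: m app)
  qed
  show "\<one>\<^bsub>?G\<^esub> \<otimes>\<^bsub>?G\<^esub> x = x" if x: "x \<in> carrier ?G" for x
  proof -
    obtain u where "u \<in> gwords X" "x = ?c u"
      using x carr by auto
    then show ?thesis
      by (simp add: one m Nil)
  qed
  show "\<exists>y\<in>carrier ?G. y \<otimes>\<^bsub>?G\<^esub> x = \<one>\<^bsub>?G\<^esub>" if x: "x \<in> carrier ?G" for x
  proof -
    obtain w where w: "w \<in> gwords X" "x = ?c w"
      using x carr by auto
    have "\<exists>v\<in>gwords X. (v @ w, []) \<in> pres_rel X R"
      using w(1)
    proof (induction w)
      case Nil
      then show ?case by (intro bexI[of _ "[]"]) (auto intro: pres_rel.refl)
    next
      case (Cons a w)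
      obtain x e where a: "a = (x, e)" "x \<in> X" and ww: "w \<in> gwords X"
        using Cons.prems by (cases a) (auto simp: gwords_def)
      obtain v where v: "v \<in> gwords X" "(v @ w, []) \<in> pres_rel X R"
        using Cons.IH ww by blast
      have "([(x, \<not> e), (x, e)], []) \<in> pres_rel X R"
        using pres_rel.cancel[OF a(2), of "\<not> e"] by simp
      then have "(v @ [(x, \<not> e), (x, e)] @ w, v @ [] @ w) \<in> pres_rel X R"
        using v(1) ww by (intro pres_rel.append pres_rel.refl)
      then have "((v @ [(x, \<not> e)]) @ a # w, []) \<in> pres_rel X R"
        using v(2) a by (auto intro: pres_rel.trans)
      moreover have "v @ [(x, \<not> e)] \<in> gwords X"
        using v(1) a by (auto simp: gwords_def)
      ultimately show ?case by blast
    qed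
    then obtain v where v: "v \<in> gwords X" "(v @ w, []) \<in> pres_rel X R" by blast
    have "?c v \<otimes>\<^bsub>?G\<^esub> x = \<one>\<^bsub>?G\<^esub>"
      using m[OF v(1) w(1)] w(2) one equiv_class_eq[OF equiv_pres_rel v(2)] by simp
    moreover have "?c v \<in> carrier ?G"
      unfolding carr by (rule bexI[of _ v]) (simp_all add: v(1))
    ultimately show ?thesis
      by (rule bexI)
  qed
qed

section \<open>The braid group\<close>

definition braid_rels :: "nat \<Rightarrow> (nat gword \<times> nat gword) set" where
  "braid_rels n =
     {([(i, True), (i + 1, True), (i, True)], [(i + 1, True), (i, True), (i + 1, True)]) | i.
        1 \<le> i \<and> i + 2 \<le> n}
   \<union> {([(i, True), (j, True)], [(j, True), (i, True)]) | i j.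
        i \<in> {1..n - 1} \<and> j \<in> {1..n - 1} \<and> \<bar>int i - int j\<bar> \<ge> 2}"

definition braid_group :: "nat \<Rightarrow> nat gword set monoid" where
  "braid_group n = presented_group {1..n - 1} (braid_rels n)"

definition braid_gen :: "nat \<Rightarrow> nat \<Rightarrow> nat gword set" where
  "braid_gen n i = pres_rel {1..n - 1} (braid_rels n) `` {[(i, True)]}"

section \<open>Laurent polynomials in two variables\<close>

text \<open>
  Finitely supported functions from exponent vectors in \<open>\<int> \<times> \<int>\<close> to \<open>\<int>\<close>. The ring structure on
  \<open>poly_mapping\<close> is the convolution product, so this is the ring of Laurent polynomials over \<open>\<int>\<close>;
  the exponent vector \<open>(p, q)\<close> belongs to the monomial \<open>t\<^sup>p b\<^sup>q\<close>.
\<close>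

type_synonym laurent2 = "(int \<times> int) \<Rightarrow>\<^sub>0 int"

definition laurent_monom :: "int \<Rightarrow> int \<Rightarrow> laurent2" where
  "laurent_monom p q = Poly_Mapping.single (p, q) 1"

definition var_t :: laurent2 where "var_t = laurent_monom 1 0"
definition var_b :: laurent2 where "var_b = laurent_monom 0 1"
definition var_t_inv :: laurent2 where "var_t_inv = laurent_monom (-1) 0"
definition var_b_inv :: laurent2 where "var_b_inv = laurent_monom 0 (-1)"

lemma laurent_monom_0_0: "laurent_monom 0 0 = 1"
  by (simp add: laurent_monom_def flip: zero_prod_def)

lemma laurent_monom_mult:
  "laurent_monom p q * laurent_monom p' q' = laurent_monom (p + p') (q + q')"
  by (simp add: laurent_monom_def mult_single)

lemma var_t_inv: "var_t * var_t_inv = 1"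
  by (simp add: var_t_def var_t_inv_def laurent_monom_mult laurent_monom_0_0)

lemma var_b_inv: "var_b * var_b_inv = 1"
  by (simp add: var_b_def var_b_inv_def laurent_monom_mult laurent_monom_0_0)

section \<open>Matrices\<close>

definition GL_laurent :: "nat \<Rightarrow> laurent2 mat monoid" where
  "GL_laurent n = units_of (ring_mat TYPE(laurent2) n ())"

definition block_antidiag :: "nat \<Rightarrow> nat \<Rightarrow> laurent2 \<Rightarrow> laurent2 \<Rightarrow> laurent2 mat" where
  "block_antidiag n i x y =
     diag_block_mat [1\<^sub>m (i - 1), mat_of_rows_list 2 [[0, x], [y, 0]], 1\<^sub>m (n - i - 1)]"

end

theory Submission
  imports Defs "HOL-Combinatorics.Transposition"
begin

text \<open>
  Each \<open>\<Psi> (\<sigma>\<^sub>i)\<close> is a monomial matrix: the permutation matrix of the transposition of two adjacent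
  indices with its nonzero entries rescaled by units. Products of monomial matrices are governed by
  composition of the permutations and multiplication of the weights, so the braid relations are
  verified row by row; the universal property of a presentation does the rest.
\<close>

section \<open>The universal property of a presentation\<close>

text \<open>The map on words that \<open>f\<close> induces before any relation is imposed. The right
  fold turns a concrete word into a right-nested product ending in the unit, the shape in which the
  braid relation is later checked for matrices.\<close>

definition gword_eval :: "('g, 'm) monoid_scheme \<Rightarrow> ('a \<Rightarrow> 'g) \<Rightarrow> 'a gword \<Rightarrow> 'g" where
  "gword_eval G f w =
     foldr (\<lambda>(x, e) a. (if e then f x else inv\<^bsub>G\<^esub> f x) \<otimes>\<^bsub>G\<^esub> a) w \<one>\<^bsub>G\<^esub>"

lemma gword_eval_Nil [simp]: "gword_eval G f [] = \<one>\<^bsub>G\<^esub>"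
  by (simp add: gword_eval_def)

lemma gword_eval_Cons [simp]:
  "gword_eval G f ((x, e) # w) = (if e then f x else inv\<^bsub>G\<^esub> f x) \<otimes>\<^bsub>G\<^esub> gword_eval G f w"
  by (simp add: gword_eval_def)

context group
begin

lemma gword_eval_closed:
  assumes "f \<in> X \<rightarrow> carrier G" and "w \<in> gwords X"
  shows "gword_eval G f w \<in> carrier G"
  using assms(2)
proof (induction w)
  case (Cons a w)
  then show ?case
    using assms(1) by (cases a) (auto simp: gwords_def Pi_iff)
qed simp

lemma gword_eval_append:
  assumes "f \<in> X \<rightarrow> carrier G" and "u \<in> gwords X" and "v \<in> gwords X"
  shows "gword_eval G f (u @ v) = gword_eval G f u \<otimes> gword_eval G f v"
  using assms(2)
proof (induction u)
  case Nil
  then show ?case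
    using gword_eval_closed[OF assms(1,3)] by simp
next
  case (Cons a u)
  obtain x e where a: "a = (x, e)" "x \<in> X" and u: "u \<in> gwords X"
    using Cons.prems by (cases a) (auto simp: gwords_def)
  have "f x \<in> carrier G"
    using a(2) assms(1) by auto
  then show ?case
    using gword_eval_closed[OF assms(1)] u assms(3) Cons.IH[OF u] a by (simp add: m_assoc)
qed

text \<open>Having the same value under evaluation is a congruence on words that cancels inverse
  letters and, by the assumption on \<open>R\<close>, respects the relations;
  \<open>pres_rel\<close> is the least such congruence.\<close>

lemma gword_eval_pres_rel:
  assumes f: "f \<in> X \<rightarrow> carrier G"
    and R: "\<And>r s. (r, s) \<in> R \<Longrightarrow> r \<in> gwords X \<Longrightarrow> s \<in> gwords X
              \<Longrightarrow> gword_eval G f r = gword_eval G f s"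
    and "(u, v) \<in> pres_rel X R"
  shows "gword_eval G f u = gword_eval G f v"
  using assms(3)
proof (induction rule: pres_rel.induct)
  case (cancel x e)
  then have "f x \<in> carrier G"
    using f by auto
  then show ?case by simp
next
  case (append u v u' v')
  then show ?case
    using pres_rel_words[OF append.hyps(1)] pres_rel_words[OF append.hyps(2)]
    by (simp add: gword_eval_append[OF f])
qed (simp_all add: R)

end

lemma carrier_presented_group:
  "carrier (presented_group X R) = (\<lambda>w. pres_rel X R `` {w}) ` gwords X"
  by (auto simp: presented_group_def quotient_def)

lemma one_presented_group: "\<one>\<^bsub>presented_group X R\<^esub> = pres_rel X R `` {[]}"
  by (simp add: presented_group_def)

text \<open>Existence half of the universal property (von Dyck): evaluation of words descends to the
  quotient.\<close>

lemma presented_group_hom_exists: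
  assumes "group G" and f: "f \<in> X \<rightarrow> carrier G"
    and R: "\<And>r s. (r, s) \<in> R \<Longrightarrow> r \<in> gwords X \<Longrightarrow> s \<in> gwords X
              \<Longrightarrow> gword_eval G f r = gword_eval G f s"
  obtains h where "group_hom (presented_group X R) G h"
    and "\<And>x. x \<in> X \<Longrightarrow> h (pres_rel X R `` {[(x, True)]}) = f x"
proof -
  interpret group G by fact
  \<comment> \<open>Evaluation is constant on each class, so its image there is a singleton and
    \<open>the_elem\<close> extracts the common value without choosing a representative.\<close>
  define h where "h = (\<lambda>A. the_elem (gword_eval G f ` A))"
  have h: "h (pres_rel X R `` {w}) = gword_eval G f w" if "w \<in> gwords X" for w
  proof -
    have "gword_eval G f v = gword_eval G f w" if "(w, v) \<in> pres_rel X R" for v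
      using gword_eval_pres_rel[OF f R that] by simp
    moreover have "(w, w) \<in> pres_rel X R"
      using that by (rule pres_rel.refl)
    ultimately have "gword_eval G f ` (pres_rel X R `` {w}) = {gword_eval G f w}"
      by blast
    then show ?thesis
      by (simp add: h_def)
  qed
  have app: "u @ v \<in> gwords X" if "u \<in> gwords X" "v \<in> gwords X" for u v
    using that by (auto simp: gwords_def)
  have "h \<in> hom (presented_group X R) G"
    unfolding hom_def
    by (auto simp: carrier_presented_group presented_group_mult h app
        gword_eval_append[OF f] gword_eval_closed[OF f])
  then have "group_hom (presented_group X R) G h"
    by (simp add: group_hom_def group_hom_axioms_def group_presented_group is_group)
  moreover have "h (pres_rel X R `` {[(x, True)]}) = f x" if "x \<in> X" for x
    using that f by (subst h) (auto simp: gwords_def Pi_iff)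
  ultimately show ?thesis
    using that by blast
qed

text \<open>Links formal inverse letters to inverses in the group, so that a homomorphism can be
  followed through words containing both kinds of letter.\<close>

lemma inv_presented_group_gen:
  assumes "x \<in> X"
  shows "inv\<^bsub>presented_group X R\<^esub> (pres_rel X R `` {[(x, True)]}) = pres_rel X R `` {[(x, False)]}"
proof (rule group.inv_equality[OF group_presented_group])
  have w: "[(x, e)] \<in> gwords X" for e
    using assms by (auto simp: gwords_def)
  show "pres_rel X R `` {[(x, False)]} \<otimes>\<^bsub>presented_group X R\<^esub> pres_rel X R `` {[(x, True)]}
      = \<one>\<^bsub>presented_group X R\<^esub>"
    using equiv_class_eq[OF equiv_pres_rel pres_rel.cancel[OF assms, of False R]]
    by (simp add: presented_group_mult[OF w w] one_presented_group)
qed (use assms in \<open>auto simp: carrier_presented_group gwords_def\<close>)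

text \<open>Splitting off the first letter and using that \<open>h\<close> respects products and
  inverses shows that \<open>h\<close> is evaluation at its own values on the generators. This
  drives the uniqueness half.\<close>

lemma presented_group_hom_eval:
  assumes "group_hom (presented_group X R) G h" and "w \<in> gwords X"
  shows "h (pres_rel X R `` {w}) = gword_eval G (\<lambda>x. h (pres_rel X R `` {[(x, True)]})) w"
  using assms(2)
proof (induction w)
  case Nil
  then show ?case
    using group_hom.hom_one[OF assms(1)] by (simp add: one_presented_group)
next
  case (Cons a w)
  interpret group_hom "presented_group X R" G h by fact
  obtain x e where a: "a = (x, e)" "x \<in> X" and w: "w \<in> gwords X"
    using Cons.prems by (cases a) (auto simp: gwords_def)
  have x: "[(x, d)] \<in> gwords X" for d
    using a(2) by (auto simp: gwords_def)
  have carr: "pres_rel X R `` {v} \<in> carrier (presented_group X R)" if "v \<in> gwords X" for v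
    using that by (auto simp: carrier_presented_group)
  have "h (pres_rel X R `` {a # w})
      = h (pres_rel X R `` {[(x, e)]}) \<otimes>\<^bsub>G\<^esub> h (pres_rel X R `` {w})"
    using presented_group_mult[OF x w, of R e] hom_mult[OF carr carr, OF x w, of e]
    by (simp add: a)
  moreover have "h (pres_rel X R `` {[(x, False)]}) = inv\<^bsub>G\<^esub> h (pres_rel X R `` {[(x, True)]})"
    using hom_inv[OF carr[OF x[of True]]] by (simp add: inv_presented_group_gen[OF a(2)])
  ultimately show ?case
    using Cons.IH[OF w] by (cases e) (simp_all add: a)
qed

lemma presented_group_hom_unique:
  assumes g: "group_hom (presented_group X R) G g" and h: "group_hom (presented_group X R) G h"
    and eq: "\<And>x. x \<in> X \<Longrightarrow> g (pres_rel X R `` {[(x, True)]}) = h (pres_rel X R `` {[(x, True)]})"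
    and "A \<in> carrier (presented_group X R)"
  shows "g A = h A"
proof -
  obtain w where w: "w \<in> gwords X" "A = pres_rel X R `` {w}"
    using assms(4) by (auto simp: carrier_presented_group)
  have "gword_eval G (\<lambda>x. g (pres_rel X R `` {[(x, True)]})) w
      = gword_eval G (\<lambda>x. h (pres_rel X R `` {[(x, True)]})) w"
    \<comment> \<open>The fold consults the assignments only at letters of \<open>w\<close>, which
      all lie in \<open>X\<close>, where they agree.\<close>
    unfolding gword_eval_def using w(1) eq by (intro foldr_cong) (auto simp: gwords_def)
  then show ?thesis
    using presented_group_hom_eval[OF g w(1)] presented_group_hom_eval[OF h w(1)] w(2) by simp
qed

section \<open>Monomial matrices\<close>

text \<open>Weights are attached to rows and \<open>p\<close> is any function, so a product is
  described by plain composition, subject only to a range condition.\<close>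

definition monomial_mat :: "nat \<Rightarrow> (nat \<Rightarrow> 'a) \<Rightarrow> (nat \<Rightarrow> nat) \<Rightarrow> 'a :: semiring_1 mat" where
  "monomial_mat n d p = mat n n (\<lambda>(r, c). if c = p r then d r else 0)"

lemma monomial_mat_carrier [simp]: "monomial_mat n d p \<in> carrier_mat n n"
  by (simp add: monomial_mat_def)

text \<open>Row \<open>r\<close> of the left factor has its entry in column \<open>p r\<close>, so
  it selects row \<open>p r\<close> of the right factor and scales it by \<open>d r\<close>.\<close>

lemma monomial_mat_mult:
  assumes "\<And>r. r < n \<Longrightarrow> p r < n"
  shows "monomial_mat n d p * monomial_mat n e q = monomial_mat n (\<lambda>r. d r * e (p r)) (q \<circ> p)"
proof (rule eq_matI)
  fix r c
  assume "r < dim_row (monomial_mat n (\<lambda>r. d r * e (p r)) (q \<circ> p))"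
    and "c < dim_col (monomial_mat n (\<lambda>r. d r * e (p r)) (q \<circ> p))"
  then have rc: "r < n" "c < n"
    by (simp_all add: monomial_mat_def)
  have "(monomial_mat n d p * monomial_mat n e q) $$ (r, c)
      = (\<Sum>k = 0..<n. (if k = p r then d r else 0) * (if c = q k then e k else 0))"
    using rc by (simp add: monomial_mat_def scalar_prod_def)
  also have "\<dots> = (\<Sum>k = 0..<n. if k = p r then d r * (if c = q k then e k else 0) else 0)"
    by (rule sum.cong) auto
  also have "\<dots> = d r * (if c = q (p r) then e (p r) else 0)"
    using assms[OF rc(1)] by simp
  finally show "(monomial_mat n d p * monomial_mat n e q) $$ (r, c)
      = monomial_mat n (\<lambda>r. d r * e (p r)) (q \<circ> p) $$ (r, c)"
    using rc by (simp add: monomial_mat_def)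
qed (simp_all add: monomial_mat_def)

lemma monomial_mat_cong:
  assumes "\<And>r. r < n \<Longrightarrow> d r = e r \<and> p r = q r"
  shows "monomial_mat n d p = monomial_mat n e q"
  unfolding monomial_mat_def using assms by (intro cong_mat) simp_all

lemma one_mat_monomial: "1\<^sub>m n = monomial_mat n (\<lambda>_. 1) id"
  by (intro eq_matI) (auto simp: monomial_mat_def)

text \<open>Matrix indices start at 0, so the block of the generator with index \<open>i\<close>
  occupies rows \<open>i - 1\<close> and \<open>i\<close>.\<close>

definition antidiag_weight :: "nat \<Rightarrow> 'a \<Rightarrow> 'a \<Rightarrow> nat \<Rightarrow> 'a :: one" where
  "antidiag_weight i x y r = (if r = i - 1 then x else if r = i then y else 1)"

lemma block_antidiag_monomial:
  assumes "i \<in> {1..n - 1}"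
  shows "block_antidiag n i x y = monomial_mat n (antidiag_weight i x y) (transpose (i - 1) i)"
proof -
  \<comment> \<open>The three diagonal blocks then have sizes \<open>k\<close>, 2 and
    \<open>m\<close>, which eliminates truncated subtraction.\<close>
  obtain k m where i: "i = Suc k" and n: "n = k + 2 + m"
    using assms nat_le_iff_add[of "Suc i" n] by (cases i) auto
  let ?J = "mat_of_rows_list 2 [[0, x], [y, 0]]"
  have dim: "dim_row ?J = 2" "dim_col ?J = 2"
    by (simp_all add: mat_of_rows_list_def)
  have J: "?J $$ (0, 0) = 0" "?J $$ (0, Suc 0) = x" "?J $$ (Suc 0, 0) = y" "?J $$ (Suc 0, Suc 0) = 0"
    by (simp_all add: mat_of_rows_list_def)
  \<comment> \<open>Each index lies in the first block, in one of the two middle rows, or in the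
    last block; the entries are compared over all pairs of these cases.\<close>
  have split: "r < k \<or> r = k \<or> r = Suc k \<or> (\<exists>s. r = k + 2 + s \<and> s < m)" if "r < n" for r
    using that n by presburger
  show ?thesis
  proof (rule eq_matI)
    fix r c
    assume "r < dim_row (monomial_mat n (antidiag_weight i x y) (transpose (i - 1) i))"
      and "c < dim_col (monomial_mat n (antidiag_weight i x y) (transpose (i - 1) i))"
    then have rc: "r < n" "c < n"
      by (simp_all add: monomial_mat_def)
    show "block_antidiag n i x y $$ (r, c)
        = monomial_mat n (antidiag_weight i x y) (transpose (i - 1) i) $$ (r, c)"
      using split[OF rc(1)] split[OF rc(2)]
      by (elim disjE exE conjE)
         (simp_all add: block_antidiag_def monomial_mat_def antidiag_weight_def transpose_def
            i n dim J)
  qed (simp_all add: block_antidiag_def monomial_mat_def dim i n)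
qed

lemma block_antidiag_carrier:
  assumes "i \<in> {1..n - 1}"
  shows "block_antidiag n i x y \<in> carrier_mat n n"
  by (simp add: block_antidiag_monomial[OF assms])

lemma monomial_mat_mult_transpose:
  assumes "i \<in> {1..n - 1}"
  shows "monomial_mat n d (transpose (i - 1) i) * monomial_mat n e q
       = monomial_mat n (\<lambda>r. d r * e (transpose (i - 1) i r)) (q \<circ> transpose (i - 1) i)"
  by (rule monomial_mat_mult) (use assms in \<open>auto simp: transpose_def\<close>)

text \<open>The transposition is an involution and pairs the weights crosswise: row
  \<open>i - 1\<close> gives \<open>x * y'\<close> and row \<open>i\<close> gives
  \<open>y * x'\<close>. Hence the two inverted variables trade places in the inverse
  matrix.\<close>

lemma block_antidiag_mult_inverse:
  assumes i: "i \<in> {1..n - 1}" and "x * y' = 1" and "y * x' = 1"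
  shows "block_antidiag n i x y * block_antidiag n i x' y' = 1\<^sub>m n"
  unfolding block_antidiag_monomial[OF i] one_mat_monomial monomial_mat_mult_transpose[OF i]
  by (rule monomial_mat_cong) (use assms in \<open>auto simp: antidiag_weight_def transpose_def\<close>)

text \<open>Both sides exchange \<open>i - 1\<close> with \<open>i + 1\<close>, with weights
  \<open>x * x\<close> and \<open>y * y\<close> on these rows. Row \<open>i\<close> carries
  \<open>y * x\<close> on the left and \<open>x * y\<close> on the right, which is where
  commutativity of the ring enters.\<close>

lemma block_antidiag_braid:
  assumes "1 \<le> i" and "i + 2 \<le> n"
  shows "block_antidiag n i x y * (block_antidiag n (i + 1) x y * block_antidiag n i x y)
       = block_antidiag n (i + 1) x y * (block_antidiag n i x y * block_antidiag n (i + 1) x y)"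
proof -
  have i: "i \<in> {1..n - 1}" "i + 1 \<in> {1..n - 1}"
    using assms by auto
  obtain k where k: "i = Suc k"
    using assms(1) by (cases i) auto
  show ?thesis
    unfolding block_antidiag_monomial[OF i(1)] block_antidiag_monomial[OF i(2)]
      monomial_mat_mult_transpose[OF i(1)] monomial_mat_mult_transpose[OF i(2)]
    by (rule monomial_mat_cong) (auto simp: antidiag_weight_def transpose_def k mult.commute)
qed

text \<open>The two blocks occupy disjoint pairs of rows.\<close>

lemma block_antidiag_commute:
  assumes i: "i \<in> {1..n - 1}" and j: "j \<in> {1..n - 1}" and "\<bar>int i - int j\<bar> \<ge> 2"
  shows "block_antidiag n i x y * block_antidiag n j x y
       = block_antidiag n j x y * block_antidiag n i x y"
proof -
  have ij: "i \<noteq> j" "i - 1 \<noteq> j" "j - 1 \<noteq> i" "i - 1 \<noteq> j - 1" "i - 1 \<noteq> i" "j - 1 \<noteq> j"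
    using assms by auto
  show ?thesis
    unfolding block_antidiag_monomial[OF i] block_antidiag_monomial[OF j]
      monomial_mat_mult_transpose[OF i] monomial_mat_mult_transpose[OF j]
    by (rule monomial_mat_cong) (use ij in \<open>auto simp: antidiag_weight_def transpose_def\<close>)
qed

section \<open>The representation\<close>

lemma group_GL_laurent: "group (GL_laurent n)"
  unfolding GL_laurent_def
  by (intro monoid.units_group ring.is_monoid ring_mat)

lemma GL_laurent_simps:
  "A \<otimes>\<^bsub>GL_laurent n\<^esub> B = A * B" "\<one>\<^bsub>GL_laurent n\<^esub> = 1\<^sub>m n"
  by (simp_all add: GL_laurent_def units_of_def ring_mat_def)

lemma carrier_GL_laurentI:
  assumes "A \<in> carrier_mat n n" "B \<in> carrier_mat n n" "A * B = 1\<^sub>m n" "B * A = 1\<^sub>m n"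
  shows "A \<in> carrier (GL_laurent n)"
  using assms by (auto simp: GL_laurent_def units_of_def Units_def ring_mat_def)

theorem theorem2p4:
  fixes n :: nat
  assumes "n \<ge> 2"
  shows "\<exists>\<Psi>. group_hom (braid_group n) (GL_laurent n) \<Psi>
           \<and> (\<forall>i\<in>{1..n - 1}. \<Psi> (braid_gen n i) = block_antidiag n i var_t var_b)
           \<and> (\<forall>i\<in>{1..n - 1}. \<Psi> (inv\<^bsub>braid_group n\<^esub> (braid_gen n i))
                               = block_antidiag n i var_b_inv var_t_inv)
           \<and> (\<forall>\<Phi>. group_hom (braid_group n) (GL_laurent n) \<Phi>
                  \<and> (\<forall>i\<in>{1..n - 1}. \<Phi> (braid_gen n i) = block_antidiag n i var_t var_b)
                  \<longrightarrow> (\<forall>x\<in>carrier (braid_group n). \<Phi> x = \<Psi> x))"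
proof -
  let ?X = "{1..n - 1}" and ?f = "\<lambda>i. block_antidiag n i var_t var_b"
    and ?g = "\<lambda>i. block_antidiag n i var_b_inv var_t_inv"
  interpret GL: group "GL_laurent n" by (rule group_GL_laurent)
  have fg: "?f i * ?g i = 1\<^sub>m n" and gf: "?g i * ?f i = 1\<^sub>m n" if "i \<in> ?X" for i
    using var_t_inv var_b_inv
    by (auto intro!: block_antidiag_mult_inverse[OF that] simp: mult.commute)
  \<comment> \<open>Membership in the general linear group needs an inverse with Laurent polynomial
    entries; each of the two matrices supplies it for the other.\<close>
  have f: "?f i \<in> carrier (GL_laurent n)" and g: "?g i \<in> carrier (GL_laurent n)" if "i \<in> ?X" for i
    using carrier_GL_laurentI[OF block_antidiag_carrier block_antidiag_carrier, OF that that]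
      fg[OF that] gf[OF that] by blast+
  have f_Pi: "?f \<in> ?X \<rightarrow> carrier (GL_laurent n)"
    using f by blast
  have rels: "gword_eval (GL_laurent n) ?f r = gword_eval (GL_laurent n) ?f s"
    if rs: "(r, s) \<in> braid_rels n" for r s
  proof -
    \<comment> \<open>Removes the unit matrix that ends the evaluation of a word.\<close>
    note one_right = right_mult_one_mat[OF block_antidiag_carrier]
    from rs consider
        (braid) i where "1 \<le> i" "i + 2 \<le> n" "r = [(i, True), (i + 1, True), (i, True)]"
          "s = [(i + 1, True), (i, True), (i + 1, True)]"
      | (commute) i j where "i \<in> ?X" "j \<in> ?X" "\<bar>int i - int j\<bar> \<ge> 2"
          "r = [(i, True), (j, True)]" "s = [(j, True), (i, True)]"
      unfolding braid_rels_def by blast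
    then show ?thesis
    proof cases
      case braid
      then have "i \<in> ?X" "i + 1 \<in> ?X" by auto
      then show ?thesis
        using block_antidiag_braid[OF braid(1,2)] braid(3,4)
        by (simp add: GL_laurent_simps one_right del: atLeastAtMost_iff)
    next
      case commute
      then show ?thesis
        using block_antidiag_commute[OF commute(1-3)]
        by (simp add: GL_laurent_simps one_right del: atLeastAtMost_iff)
    qed
  qed
  obtain \<Psi> where hom: "group_hom (braid_group n) (GL_laurent n) \<Psi>"
    and gen: "\<And>i. i \<in> ?X \<Longrightarrow> \<Psi> (braid_gen n i) = ?f i"
    using presented_group_hom_exists[OF group_GL_laurent f_Pi, of "braid_rels n"] rels
    unfolding braid_group_def braid_gen_def by blast
  have "\<Psi> (inv\<^bsub>braid_group n\<^esub> (braid_gen n i)) = ?g i" if i: "i \<in> ?X" for i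
  proof -
    have "braid_gen n i \<in> carrier (braid_group n)"
      using i by (auto simp: braid_gen_def braid_group_def carrier_presented_group gwords_def)
    then have "\<Psi> (inv\<^bsub>braid_group n\<^esub> (braid_gen n i)) = inv\<^bsub>GL_laurent n\<^esub> ?f i"
      using group_hom.hom_inv[OF hom] gen[OF i] by simp
    also have "\<dots> = ?g i"
      \<comment> \<open>In a group a left inverse is the inverse, so \<open>gf\<close>
        suffices.\<close>
      using f[OF i] g[OF i] gf[OF i] by (intro GL.inv_equality) (simp_all add: GL_laurent_simps)
    finally show ?thesis .
  qed
  moreover have "\<Phi> x = \<Psi> x"
    if "group_hom (braid_group n) (GL_laurent n) \<Phi>" "\<forall>i\<in>?X. \<Phi> (braid_gen n i) = ?f i"
      "x \<in> carrier (braid_group n)" for \<Phi> x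
    using presented_group_hom_unique[of ?X "braid_rels n" "GL_laurent n" \<Phi> \<Psi> x] that hom gen
    by (simp add: braid_group_def braid_gen_def)
  ultimately show ?thesis
    using hom gen by blast
qed

end
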